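(* Consider the general heterogeneous Deffuant-Weisbuch (DW) model described in the context. If there exist three (distinct) agents $i,j,k\in\mathcal{N}$ satisfying: (1) $r_k\leq r_i<r_j$; and (2) $\mu_i<1/2$ and $\mu_j\leq 1/2$, or $\mu_i\leq 1/2$ and $\mu_j<1/2$, then with probability one $$\sup_{X(0)\in\mathbb{R}^{n\times d}}\tau_{X(0)}(r_j/2)=\infty.$$
   Context: Setting (general heterogeneous DW model). Let $n\geq 3$, $d\geq 1$ be integers and $\mathcal{N}=\{1,\dots,n\}$ the set of agents. Each agent $i\in\mathcal{N}$ has a confidence bound $r_i>0$ and a weighting factor $\mu_i\in(0,1)$ (arbitrary, possibly different across agents). At each time $t\in\{0,1,2,\dots\}$ agent $i$ has an opinion $\mathbf{x}_i(t)\in\mathbb{R}^d$, and $X(t)=(\mathbf{x}_1(t),\dots,\mathbf{x}_n(t))^\top\in\mathbb{R}^{n\times d}$; the initial state $X(0)$ is deterministic. $\|\cdot\|$ is the Euclidean norm and $\mathbb{1}_{\{\cdot\}}$ is the indicator (equal to $1$ if the property holds and $0$ otherwise). Let $\mathcal{A}=\{\{i,j\}: i,j\in\mathcal{N},\ i<j\}$. At each time $t\ge 0$ a pair $\{i_t,j_t\}$ is selected uniformly at random from $\mathcal{A}$, independently over time; $\mathbb{P}$ is the corresponding product probability measure on $\Omega=\mathcal{A}^\infty$, so that a sample $\omega\in\Omega$ is an infinite sequence of selected pairs (which does not depend on $X(0)$). The opinions are updated by $$\mathbf{x}_{i_t}(t+1)=\mathbf{x}_{i_t}(t)+\mu_{i_t}\mathbb{1}_{\{\|\mathbf{x}_{j_t}(t)-\mathbf{x}_{i_t}(t)\|\le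 r_{i_t}\}}(\mathbf{x}_{j_t}(t)-\mathbf{x}_{i_t}(t)),$$ $$\mathbf{x}_{j_t}(t+1)=\mathbf{x}_{j_t}(t)+\mu_{j_t}\mathbb{1}_{\{\|\mathbf{x}_{j_t}(t)-\mathbf{x}_{i_t}(t)\|\le r_{j_t}\}}(\mathbf{x}_{i_t}(t)-\mathbf{x}_{j_t}(t)),$$ and $\mathbf{x}_k(t+1)=\mathbf{x}_k(t)$ for $k\in\mathcal{N}\setminus\{i_t,j_t\}$. Convergence time. For $\varepsilon>0$ and an initial state $X(0)$, if $\mathbf{x}_i(t)$ converges as $t\to\infty$ to some $\mathbf{x}_i^*$ for every $i\in\mathcal{N}$, define $$\tau_{X(0)}(\varepsilon):=\min\left\{t\in\mathbb{Z}^+:\ \max_{i\in\mathcal{N}}\|\mathbf{x}_i(t)-\mathbf{x}_i^*\|\le\varepsilon\right\},$$ where $\mathbb{Z}^+$ is the set of positive integers. For a given sample $\omega$, the supremum over $X(0)$ is taken over those $X(0)$ for which $\tau_{X(0)}$ is defined. *)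

theory Defs
  imports "HOL-Probability.Probability"
begin

text \<open>The agents are the elements of \<open>{1..n}\<close>. A state is a function from
  agents to opinions; its values outside \<open>{1..n}\<close> play no role. Every
  unordered pair of distinct agents is represented by the ordered pair of its elements.\<close>

definition agent_pairs :: "nat \<Rightarrow> (nat \<times> nat) set" where
  "agent_pairs n = {(i, j). i \<in> {1..n} \<and> j \<in> {1..n} \<and> i < j}"

definition pair_sequences :: "nat \<Rightarrow> (nat \<Rightarrow> nat \<times> nat) measure" where
  "pair_sequences n = PiM UNIV (\<lambda>_. uniform_count_measure (agent_pairs n))"

definition dw_step ::
  "(nat \<Rightarrow> real) \<Rightarrow> (nat \<Rightarrow> real) \<Rightarrow> nat \<times> nat \<Rightarrow> (nat \<Rightarrow> real ^ 'd) \<Rightarrow> (nat \<Rightarrow> real ^ 'd)" where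
  "dw_step r \<mu> = (\<lambda>(i, j) x k.
     if k = i then x i + (\<mu> i * of_bool (norm (x j - x i) \<le> r i)) *\<^sub>R (x j - x i)
     else if k = j then x j + (\<mu> j * of_bool (norm (x j - x i) \<le> r j)) *\<^sub>R (x i - x j)
     else x k)"

primrec dw_state ::
  "(nat \<Rightarrow> real) \<Rightarrow> (nat \<Rightarrow> real) \<Rightarrow> (nat \<Rightarrow> real ^ 'd) \<Rightarrow> (nat \<Rightarrow> nat \<times> nat) \<Rightarrow> nat \<Rightarrow> (nat \<Rightarrow> real ^ 'd)" where
  "dw_state r \<mu> X0 \<omega> 0 = X0"
| "dw_state r \<mu> X0 \<omega> (Suc t) = dw_step r \<mu> (\<omega> t) (dw_state r \<mu> X0 \<omega> t)"

definition dw_converges ::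
  "nat \<Rightarrow> (nat \<Rightarrow> real) \<Rightarrow> (nat \<Rightarrow> real) \<Rightarrow> (nat \<Rightarrow> real ^ 'd) \<Rightarrow> (nat \<Rightarrow> nat \<times> nat) \<Rightarrow> bool" where
  "dw_converges n r \<mu> X0 \<omega> \<longleftrightarrow> (\<forall>i\<in>{1..n}. convergent (\<lambda>t. dw_state r \<mu> X0 \<omega> t i))"

text \<open>The following value is meaningful only if \<open>dw_converges n r \<mu> X0 \<omega>\<close> and \<open>\<epsilon> > 0\<close>;
  then a positive time as required exists.\<close>

definition dw_conv_time ::
  "nat \<Rightarrow> (nat \<Rightarrow> real) \<Rightarrow> (nat \<Rightarrow> real) \<Rightarrow> (nat \<Rightarrow> real ^ 'd) \<Rightarrow> (nat \<Rightarrow> nat \<times> nat) \<Rightarrow> real \<Rightarrow> nat" where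
  "dw_conv_time n r \<mu> X0 \<omega> \<epsilon> =
     (LEAST t. t > 0 \<and>
        (MAX i\<in>{1..n}. norm (dw_state r \<mu> X0 \<omega> t i - lim (\<lambda>s. dw_state r \<mu> X0 \<omega> s i))) \<le> \<epsilon>)"

end

theory Submission
  imports Defs
begin

text \<open>
  The idea is to let the initial state depend on the random sequence \<open>\<omega>\<close>, so that \<open>i\<close>, \<open>j\<close> and \<open>k\<close>
  reach a consensus, but \<open>j\<close> and \<open>k\<close> are more than \<open>r j\<close> apart until a prescribed time. At every
  moment before that time one of these two is more than \<open>r j / 2\<close> away from the common limit,
  which bounds the convergence time from below.

  All opinions are placed on a line. The agents outside the trio are so far from each
  other and from the trio that they never interact. Agent \<open>k\<close> sits at \<open>0\<close>, agent \<open>j\<close> slightly beyond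
  \<open>r j\<close>, and agent \<open>i\<close> slightly below \<open>j\<close>, where \<open>k\<close> and \<open>i\<close> do not react to each other since
  \<open>r k \<le> r i < r j\<close>. The opinion of \<open>j\<close> creeps towards \<open>k\<close> only by its meetings with \<open>i\<close>. Because
  \<open>\<mu> i + \<mu> j < 1\<close>, it never catches up with \<open>i\<close> and every such meeting moves it
  strictly. Hence, for any time at which \<open>i\<close> and \<open>j\<close> are selected, the initial state can be adjusted
  so that \<open>j\<close> comes within distance \<open>r j\<close> of \<open>k\<close> exactly then (\<open>delayed_start\<close>).

  From that time on \<open>j\<close> reacts to \<open>k\<close> and can be used to drag \<open>i\<close> towards \<open>k\<close>. There is a fixed finite
  word of selections that brings the three agents within \<open>r k\<close> of each other, however late the first
  contact was (\<open>gathering_word\<close>). With probability one every finite word occurs arbitrarily late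
  (\<open>AE_word_recurs\<close>), so the first contact can be timed to be followed by that word.
  A trio within \<open>r k\<close> interacts without restriction, and the recurrence of a short word
  forces consensus (\<open>gathered_consensus\<close>).
\<close>

section \<open>Finite words in a random sequence\<close>

definition occurs_at :: "(nat \<Rightarrow> 'a) \<Rightarrow> nat \<Rightarrow> 'a list \<Rightarrow> bool" where
  "occurs_at \<omega> t w \<longleftrightarrow> (\<forall>s<length w. \<omega> (t + s) = w ! s)"

lemma occurs_at_append:
  "occurs_at \<omega> t (u @ v) \<longleftrightarrow> occurs_at \<omega> t u \<and> occurs_at \<omega> (t + length u) v"
proof
  assume *: "occurs_at \<omega> t (u @ v)"
  have "\<omega> (t + s) = u ! s" if "s < length u" for s
    using * that by (auto simp: occurs_at_def nth_append split: if_splits)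
  moreover have "\<omega> (t + length u + s) = v ! s" if "s < length v" for s
    using * that unfolding occurs_at_def by (auto dest: spec[of _ "length u + s"] simp: add.assoc)
  ultimately show "occurs_at \<omega> t u \<and> occurs_at \<omega> (t + length u) v"
    by (simp add: occurs_at_def)
next
  assume *: "occurs_at \<omega> t u \<and> occurs_at \<omega> (t + length u) v"
  have "\<omega> (t + s) = (u @ v) ! s" if s: "s < length u + length v" for s
  proof (cases "s < length u")
    case False
    then have "\<omega> (t + length u + (s - length u)) = v ! (s - length u)"
      using * s unfolding occurs_at_def by (metis add_less_cancel_left le_add_diff_inverse linorder_not_less)
    with False show ?thesis by (simp add: nth_append)
  qed (use * in \<open>auto simp: occurs_at_def nth_append\<close>)
  then show "occurs_at \<omega> t (u @ v)" by (simp add: occurs_at_def)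
qed

text \<open>Cutting off the first \<open>length w\<close> letters leaves a sequence with the same distribution,
  independent of the letters cut off. If \<open>w\<close> never occurs, then it is not the initial word and it never
  occurs in what is left, so the probability \<open>P\<close> of that event satisfies \<open>P \<le> (1 - p) P\<close> with
  \<open>p > 0\<close>, whence \<open>P = 0\<close>.\<close>

lemma AE_word_occurs:
  assumes A: "finite A" and w: "set w \<subseteq> A" "w \<noteq> []"
  shows "AE \<omega> in PiM UNIV (\<lambda>_::nat. uniform_count_measure A). \<exists>t. occurs_at \<omega> t w"
proof -
  let ?M = "uniform_count_measure A"
  from w have "A \<noteq> {}" by auto
  interpret M: prob_space ?M
    using A \<open>A \<noteq> {}\<close> by (rule prob_space_uniform_count_measure)
  interpret sequence_space ?M ..
  interpret SS: pair_prob_space S S ..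
  have occ[measurable]: "Measurable.pred S (\<lambda>\<omega>. occurs_at \<omega> t w)" for t
  proof -
    have "Measurable.pred S (\<lambda>\<omega>. \<omega> (t + s) = w ! s)" for s
      by (rule measurable_compose[OF measurable_component_singleton[of "t + s" UNIV "\<lambda>_. ?M"]])
         (auto simp: measurable_def)
    then show ?thesis
      unfolding occurs_at_def by measurable
  qed
  let ?L = "length w"
  define E where "E = {\<omega> \<in> space S. occurs_at \<omega> 0 w}"
  define N where "N = {\<omega> \<in> space S. \<forall>t. \<not> occurs_at \<omega> t w}"
  have [measurable]: "E \<in> sets S" "N \<in> sets S"
    unfolding E_def N_def by measurable
  have wA: "w ! s \<in> A" if "s < ?L" for s
    using w that by (auto simp: subset_iff)
  have "E = prod_emb UNIV (\<lambda>_. ?M) {..<?L} (\<Pi>\<^sub>E s\<in>{..<?L}. {w ! s})"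
    unfolding E_def occurs_at_def prod_emb_def
    by (auto simp: space_PiM PiE_iff restrict_def extensional_def)
  then have "measure S E = (\<Prod>s<?L. measure ?M {w ! s})"
    using wA by (subst measure_PiM_emb[symmetric]) (auto simp: sets_uniform_count_measure)
  also have "\<dots> = (\<Prod>s<?L. 1 / card A)"
    using A wA by (intro prod.cong) (auto simp: measure_uniform_count_measure)
  finally have E_pos: "measure S E > 0"
    using A \<open>A \<noteq> {}\<close> by (simp add: card_gt_0_iff)
  have "measure S N = measure (distr (S \<Otimes>\<^sub>M S) S (\<lambda>(\<omega>, \<omega>'). comb_seq ?L \<omega> \<omega>')) N"
    by (simp add: PiM_comb_seq)
  also have "\<dots> = measure (S \<Otimes>\<^sub>M S) ((\<lambda>(\<omega>, \<omega>'). comb_seq ?L \<omega> \<omega>') -` N \<inter> space (S \<Otimes>\<^sub>M S))"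
    by (intro measure_distr measurable_comb_seq) simp
  also have "\<dots> \<le> measure (S \<Otimes>\<^sub>M S) ((space S - E) \<times> N)"
  proof (rule SS.finite_measure_mono)
    show "(\<lambda>(\<omega>, \<omega>'). comb_seq ?L \<omega> \<omega>') -` N \<inter> space (S \<Otimes>\<^sub>M S) \<subseteq> (space S - E) \<times> N"
    proof clarify
      fix a b assume ab: "(a, b) \<in> space (S \<Otimes>\<^sub>M S)" and N: "comb_seq ?L a b \<in> N"
      then have sp: "a \<in> space S" "b \<in> space S" by (auto simp: space_pair_measure)
      have "occurs_at (comb_seq ?L a b) 0 w \<longleftrightarrow> occurs_at a 0 w"
        by (simp add: occurs_at_def comb_seq_less)
      moreover have "occurs_at (comb_seq ?L a b) (t + ?L) w \<longleftrightarrow> occurs_at b t w" for t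
        using comb_seq_add[of ?L a b "t + s" for s] by (simp add: occurs_at_def add_ac)
      ultimately show "a \<in> space S - E \<and> b \<in> N"
        using N sp unfolding E_def N_def by blast
    qed
  qed simp
  also have "\<dots> = measure S (space S - E) * measure S N"
    by (subst measure_def, subst P.emeasure_pair_measure_Times)
       (auto simp: enn2real_mult measure_def)
  also have "\<dots> = (1 - measure S E) * measure S N"
    by (simp add: prob_compl)
  finally have "measure S E * measure S N \<le> 0"
    by (simp add: algebra_simps)
  then have "measure S N = 0"
    using E_pos by (simp add: mult_le_0_iff measure_le_0_iff)
  then have "N \<in> null_sets S"
    by (simp add: null_sets_def emeasure_eq_measure)
  then show ?thesis
    by (rule AE_I') (auto simp: N_def)
qed

lemma AE_word_recurs:
  assumes A: "finite A" and w: "set w \<subseteq> A" "w \<noteq> []"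
  shows "AE \<omega> in PiM UNIV (\<lambda>_::nat. uniform_count_measure A). \<forall>T. \<exists>t\<ge>T. occurs_at \<omega> t w"
proof (subst AE_all_countable, rule allI)
  fix T
  \<comment> \<open>An occurrence of \<open>w\<close> preceded by \<open>T\<close> letters of padding starts no earlier than \<open>T\<close>.\<close>
  let ?u = "replicate T (hd w)"
  have "AE \<omega> in PiM UNIV (\<lambda>_::nat. uniform_count_measure A). \<exists>t. occurs_at \<omega> t (?u @ w)"
    using w by (intro AE_word_occurs A) (cases w, auto)
  then show "AE \<omega> in PiM UNIV (\<lambda>_::nat. uniform_count_measure A). \<exists>t\<ge>T. occurs_at \<omega> t w"
    by eventually_elim (auto simp: occurs_at_append intro: le_add2)
qed

section \<open>The dynamics on a line\<close>

definition meet :: "nat \<Rightarrow> nat \<Rightarrow> nat \<times> nat" where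
  "meet a b = (min a b, max a b)"

text \<open>All opinions will lie on one line through the origin. The line is invariant under the dynamics,
  so coordinates along it suffice; this step is the update rule for \<open>d = 1\<close>.\<close>

definition line_step ::
  "(nat \<Rightarrow> real) \<Rightarrow> (nat \<Rightarrow> real) \<Rightarrow> nat \<times> nat \<Rightarrow> (nat \<Rightarrow> real) \<Rightarrow> (nat \<Rightarrow> real)" where
  "line_step r \<mu> = (\<lambda>(a, b) x c.
     if c = a then x a + \<mu> a * of_bool (\<bar>x b - x a\<bar> \<le> r a) * (x b - x a)
     else if c = b then x b + \<mu> b * of_bool (\<bar>x b - x a\<bar> \<le> r b) * (x a - x b)
     else x c)"

primrec line_state ::
  "(nat \<Rightarrow> real) \<Rightarrow> (nat \<Rightarrow> real) \<Rightarrow> (nat \<Rightarrow> real) \<Rightarrow> (nat \<Rightarrow> nat \<times> nat) \<Rightarrow> nat \<Rightarrow> (nat \<Rightarrow> real)" where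
  "line_state r \<mu> x \<omega> 0 = x"
| "line_state r \<mu> x \<omega> (Suc t) = line_step r \<mu> (\<omega> t) (line_state r \<mu> x \<omega> t)"

lemma dw_state_on_line:
  fixes e :: "real ^ 'd"
  assumes "norm e = 1"
  shows "dw_state r \<mu> (\<lambda>a. x a *\<^sub>R e) \<omega> t = (\<lambda>a. line_state r \<mu> x \<omega> t a *\<^sub>R e)"
proof (induction t)
  case (Suc t)
  have "norm (a *\<^sub>R e - b *\<^sub>R e) = \<bar>a - b\<bar>" for a b
    using assms by (simp flip: scaleR_diff_left)
  with Suc show ?case
    by (cases "\<omega> t") (auto simp: dw_step_def line_step_def fun_eq_iff scaleR_add_left
        scaleR_diff_left scaleR_diff_right right_diff_distrib)
qed simp

lemma line_state_word:
  "occurs_at \<omega> t w \<Longrightarrow>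
    line_state r \<mu> x \<omega> (t + length w) = fold (line_step r \<mu>) w (line_state r \<mu> x \<omega> t)"
proof (induction w rule: rev_induct)
  case (snoc p w)
  then have "occurs_at \<omega> t w" "\<omega> (t + length w) = p"
    by (auto simp: occurs_at_append) (simp add: occurs_at_def)
  with snoc.IH show ?case by simp
qed simp

lemma line_step_meet:
  assumes "a \<noteq> b"
  shows "line_step r \<mu> (meet a b) x =
    x(a := x a + \<mu> a * of_bool (\<bar>x b - x a\<bar> \<le> r a) * (x b - x a),
      b := x b + \<mu> b * of_bool (\<bar>x b - x a\<bar> \<le> r b) * (x a - x b))"
  using assms
  by (auto simp: line_step_def meet_def min_def max_def fun_eq_iff abs_minus_commute)

lemma meet_commute: "meet a b = meet b a"
  by (simp add: meet_def min.commute max.commute)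

text \<open>The estimates behind every contraction below: an agent that moves the fraction \<open>s \<ge> \<alpha>\<close> of the way
  towards a point at distance at least \<open>e\<close> from an end of an interval keeps at least the distance
  \<open>\<alpha> e\<close> from that end.\<close>

lemma move_towards_ge:
  assumes "a \<ge> (l::real)" "b \<ge> l + e" "0 \<le> e" "0 \<le> \<alpha>" "\<alpha> \<le> s" "s \<le> 1"
  shows "a + s * (b - a) \<ge> l + \<alpha> * e"
proof -
  have "a + s * (b - a) = (1 - s) * a + s * b" by (simp add: algebra_simps)
  moreover have "(1 - s) * a \<ge> (1 - s) * l" "s * b \<ge> s * (l + e)" "s * e \<ge> \<alpha> * e"
    using assms by (auto intro!: mult_left_mono mult_right_mono)
  ultimately show ?thesis by (simp add: algebra_simps)
qed

lemma move_towards_le: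
  assumes "a \<le> (h::real)" "b \<le> h - e" "0 \<le> e" "0 \<le> \<alpha>" "\<alpha> \<le> s" "s \<le> 1"
  shows "a + s * (b - a) \<le> h - \<alpha> * e"
  using move_towards_ge[of "- h" "- a" e "- b" \<alpha> s] assms by (simp add: algebra_simps)

section \<open>Three agents isolated from the others\<close>

text \<open>The assumption \<open>\<mu> i + \<mu> j < 1\<close> is the essence of the conditions on the weighting factors: when \<open>i\<close> and \<open>j\<close> both
  move, their distance is multiplied by \<open>1 - \<mu> i - \<mu> j\<close>, so that they neither meet nor swap sides.\<close>

locale dw_trio =
  fixes n :: nat and r \<mu> :: "nat \<Rightarrow> real" and i j k :: nat
  assumes r_pos: "a \<in> {1..n} \<Longrightarrow> r a > 0"
    and \<mu>_range: "a \<in> {1..n} \<Longrightarrow> 0 < \<mu> a \<and> \<mu> a < 1"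
    and members: "i \<in> {1..n}" "j \<in> {1..n}" "k \<in> {1..n}"
    and distinct: "i \<noteq> j" "i \<noteq> k" "j \<noteq> k"
    and r_le: "r k \<le> r i" and r_less: "r i < r j"
    and \<mu>_sum: "\<mu> i + \<mu> j < 1"
begin

abbreviation "step \<equiv> line_step r \<mu>"
abbreviation "state \<equiv> line_state r \<mu>"

lemma trio_pos: "r i > 0" "r j > 0" "r k > 0"
  using r_pos members by auto

lemma trio_\<mu>: "0 < \<mu> i" "\<mu> i < 1" "0 < \<mu> j" "\<mu> j < 1" "0 < \<mu> k" "\<mu> k < 1"
  using \<mu>_range members by auto

text \<open>The opinions of the agents outside the trio. Neighbouring spots are twice the sum of all confidence
  bounds apart, and \<open>spot 1\<close> is at least as far from every point of \<open>{0..2 * r j}\<close>, where the trio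
  will stay; so these agents never interact with anyone.\<close>

definition spot :: "nat \<Rightarrow> real" where
  "spot m = 2 * (\<Sum>a\<in>{1..n}. r a) * (real m + 1)"

text \<open>The positions of the outsiders belong to this condition because it is to be preserved by the selection
  of every agent pair (\<open>trapped_step\<close>).\<close>

definition trapped :: "real \<Rightarrow> real \<Rightarrow> (nat \<Rightarrow> real) \<Rightarrow> bool" where
  "trapped l h x \<longleftrightarrow> {x i, x j, x k} \<subseteq> {l..h} \<and> (\<forall>m\<in>{1..n} - {i, j, k}. x m = spot m)"

lemma trapped_mono: "trapped l h x \<Longrightarrow> l' \<le> l \<Longrightarrow> h \<le> h' \<Longrightarrow> trapped l' h' x"
  by (auto simp: trapped_def)

lemma r_le_sum: "a \<in> {1..n} \<Longrightarrow> r a \<le> (\<Sum>a\<in>{1..n}. r a)"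
  using r_pos by (intro member_le_sum) (auto intro: less_imp_le)

lemma outsider_remote:
  assumes x: "trapped 0 (2 * r j) x" and m: "m \<in> {1..n} - {i, j, k}" and a: "a \<in> {1..n}" "a \<noteq> m"
    and c: "c \<in> {1..n}"
  shows "\<bar>x a - x m\<bar> > r c"
proof -
  let ?R = "\<Sum>a\<in>{1..n}. r a"
  have R: "r c \<le> ?R" "r j \<le> ?R" "0 < r c"
    using r_le_sum[OF c] r_le_sum[OF members(2)] r_pos[OF c] by auto
  have xm: "x m = spot m" and m1: "real m \<ge> 1"
    using x m by (auto simp: trapped_def)
  have "\<bar>x a - x m\<bar> \<ge> 2 * ?R"
  proof (cases "a \<in> {i, j, k}")
    case True
    then have "x a \<le> 2 * r j" using x by (auto simp: trapped_def)
    moreover have "spot m \<ge> 2 * ?R * 2"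
      unfolding spot_def using R m1 by (intro mult_left_mono) auto
    ultimately show ?thesis using xm R by linarith
  next
    case False
    then have "x a = spot a" using x a by (auto simp: trapped_def)
    then have "\<bar>x a - x m\<bar> = 2 * ?R * \<bar>real a - real m\<bar>"
      using xm R by (simp add: spot_def abs_mult flip: right_diff_distrib)
    also have "\<dots> \<ge> 2 * ?R * 1"
      using R a(2) by (intro mult_left_mono) auto
    finally show ?thesis by simp
  qed
  then show ?thesis using R by linarith
qed

lemma step_other:
  assumes p: "p \<in> agent_pairs n" and x: "trapped 0 (2 * r j) x"
    and new: "p \<notin> {meet i j, meet i k, meet j k}"
  shows "step p x = x"
proof -
  obtain a b where ab: "p = (a, b)" "a \<in> {1..n}" "b \<in> {1..n}" "a < b"
    using p by (auto simp: agent_pairs_def)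
  then have "p = meet a b" by (simp add: meet_def)
  then have out: "a \<notin> {i, j, k} \<or> b \<notin> {i, j, k}"
    using new ab(4) meet_commute[of j i] meet_commute[of k i] meet_commute[of k j] by auto
  have "\<bar>x b - x a\<bar> > r c" if "c \<in> {1..n}" for c
  proof (cases "a \<in> {i, j, k}")
    case True
    then have "b \<in> {1..n} - {i, j, k}" using out ab by blast
    from outsider_remote[OF x this _ _ that, of a] ab show ?thesis
      by (simp add: abs_minus_commute)
  next
    case False
    then have "a \<in> {1..n} - {i, j, k}" using ab by blast
    from outsider_remote[OF x this _ _ that, of b] ab show ?thesis by simp
  qed
  from this[OF ab(2)] this[OF ab(3)]
  have "\<bar>x b - x a\<bar> > r a \<and> \<bar>x b - x a\<bar> > r b" ..
  then show ?thesis
    by (simp add: ab(1) line_step_def fun_eq_iff)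
qed

lemma trapped_meet:
  assumes "trapped l h x" "a \<in> {i, j, k}" "b \<in> {i, j, k}" "a \<noteq> b"
  shows "trapped l h (step (meet a b) x)"
proof -
  have x: "x c \<in> {l..h}" if "c \<in> {i, j, k}" for c
    using assms(1) that by (auto simp: trapped_def)
  have *: "x c + \<mu> c * of_bool P * (x d - x c) \<in> {l..h}"
    if "c \<in> {i, j, k}" "d \<in> {i, j, k}" for c d P
  proof (cases P)
    case True
    have "0 \<le> \<mu> c" "\<mu> c \<le> 1" using that(1) trio_\<mu> by auto
    then show ?thesis
      using x[OF that(1)] x[OF that(2)] move_towards_ge[of l "x c" 0 "x d" 0 "\<mu> c"]
        move_towards_le[of "x c" h "x d" 0 0 "\<mu> c"] True by simp
  qed (use x[OF that(1)] in simp)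
  have "step (meet a b) x c \<in> {l..h}" if "c \<in> {i, j, k}" for c
    using *[OF assms(2,3)] *[OF assms(3,2)] x[OF that]
    unfolding line_step_meet[OF assms(4)] by (simp add: assms(4))
  moreover have "step (meet a b) x m = x m" if "m \<in> {1..n} - {i, j, k}" for m
    using that assms(2,3) unfolding line_step_meet[OF assms(4)] by auto
  ultimately show ?thesis
    using assms(1) by (simp add: trapped_def)
qed

lemma trapped_step:
  assumes "p \<in> agent_pairs n" "trapped l h x" "0 \<le> l" "h \<le> 2 * r j"
  shows "trapped l h (step p x)"
proof (cases "p \<in> {meet i j, meet i k, meet j k}")
  case True
  then show ?thesis using assms(2) distinct by (auto intro: trapped_meet)
next
  case False
  then show ?thesis
    using step_other[OF assms(1)] assms(2) trapped_mono[OF assms(2,3,4)] by simp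
qed

lemma trapped_state:
  assumes "\<And>t. \<omega> t \<in> agent_pairs n" "trapped l h (state x \<omega> s)" "0 \<le> l" "h \<le> 2 * r j" "s \<le> t"
  shows "trapped l h (state x \<omega> t)"
  using assms(5) by (induction t rule: dec_induct) (use assms in \<open>auto intro: trapped_step\<close>)

definition gathered :: "(nat \<Rightarrow> real) \<Rightarrow> bool" where
  "gathered x \<longleftrightarrow> (\<exists>l h. trapped l h x \<and> 0 \<le> l \<and> h \<le> 2 * r j \<and> h - l \<le> r k)"

text \<open>A bound from below for every fraction of the way that an agent of the trio moves, and for the remaining
  fraction.\<close>

definition sway :: real where
  "sway = Min ((\<lambda>a. min (\<mu> a) (1 - \<mu> a)) ` {i, j, k})"

lemma sway: "0 < sway" "sway < 1" "a \<in> {i, j, k} \<Longrightarrow> sway \<le> \<mu> a" "a \<in> {i, j, k} \<Longrightarrow> sway \<le> 1 - \<mu> a"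
proof -
  have "sway \<le> min (\<mu> a) (1 - \<mu> a)" if "a \<in> {i, j, k}" for a
    unfolding sway_def using that by (intro Min_le) auto
  note le = this
  show "a \<in> {i, j, k} \<Longrightarrow> sway \<le> \<mu> a" "a \<in> {i, j, k} \<Longrightarrow> sway \<le> 1 - \<mu> a"
    using le[of a] by simp_all
  show "0 < sway" using trio_\<mu> by (simp add: sway_def)
  show "sway < 1" using le[of i] trio_\<mu> by simp
qed

section \<open>Consensus of three agents within mutual reach\<close>

text \<open>A trio of diameter at most \<open>r k\<close> interacts without any restriction. If \<open>j\<close> starts in the lower half of
  the interval, then meeting \<open>j\<close> pulls \<open>i\<close> away from the upper end (and \<open>j\<close> remains away from it), and
  then meeting \<open>j\<close> pulls \<open>k\<close> away from it. The other half is symmetric. Each of the two meetings costs a factor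
  \<open>sway\<close>.\<close>

lemma diameter_contracts:
  assumes x: "trapped l h x" and lh: "0 \<le> l" "h \<le> 2 * r j" "h - l \<le> r k"
  shows "\<exists>l' h'. trapped l' h' (fold step [meet i j, meet j k] x) \<and> l \<le> l' \<and> h' \<le> h \<and>
    h' - l' = (1 - sway\<^sup>2 / 2) * (h - l)"
proof -
  define e where "e = (h - l) / 2"
  define y where "y = step (meet i j) x"
  define z where "z = step (meet j k) y"
  have xb: "l \<le> x i" "x i \<le> h" "l \<le> x j" "x j \<le> h" "l \<le> x k" "x k \<le> h"
    using x by (simp_all add: trapped_def)
  have e: "0 \<le> e" "e \<le> h - l" using xb(1,2) by (simp_all add: e_def)
  have near: "\<bar>x j - x i\<bar> \<le> r k" using xb lh by linarith
  have y: "y = x(i := x i + \<mu> i * (x j - x i), j := x j + \<mu> j * (x i - x j))"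
    unfolding y_def line_step_meet[OF distinct(1)] using near r_le r_less by simp
  have ty: "trapped l h y" unfolding y_def using x distinct(1) by (simp add: trapped_meet)
  then have yb: "l \<le> y j" "y j \<le> h" "l \<le> y k" "y k \<le> h"
    by (simp_all add: trapped_def)
  then have near': "\<bar>y k - y j\<bar> \<le> r k" using lh by linarith
  have z: "z = y(j := y j + \<mu> j * (y k - y j), k := y k + \<mu> k * (y j - y k))"
    unfolding z_def line_step_meet[OF distinct(3)] using near' r_le r_less by simp
  have tz: "trapped l h z" unfolding z_def using ty distinct(3) by (simp add: trapped_meet)
  have s0: "0 \<le> sway" using sway(1) by simp
  have s1: "sway * (sway * e) \<le> sway * e" "0 \<le> sway * e"
    using sway(1,2) e by (auto intro!: mult_left_le_one_le)
  have sj: "sway \<le> \<mu> j" "sway \<le> 1 - \<mu> j" "1 - \<mu> j \<le> 1" "\<mu> j \<le> 1"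
    and si: "sway \<le> \<mu> i" "\<mu> i \<le> 1" and sk: "sway \<le> \<mu> k" "\<mu> k \<le> 1"
    using sway(3,4) trio_\<mu> by auto
  have yj: "y j = x i + (1 - \<mu> j) * (x j - x i)"
    using distinct(1) by (simp add: y algebra_simps)
  have yi: "y i = x i + \<mu> i * (x j - x i)" and yk: "y k = x k"
    using distinct by (simp_all add: y)
  have zj: "z j = y k + (1 - \<mu> j) * (y j - y k)"
    using distinct(3) by (simp add: z algebra_simps)
  have zk: "z k = y k + \<mu> k * (y j - y k)" and zi: "z i = y i"
    using distinct by (simp_all add: z)
  have fold_eq: "fold step [meet i j, meet j k] x = z"
    by (simp add: y_def z_def)
  have size: "h - l - sway * (sway * e) = (1 - sway\<^sup>2 / 2) * (h - l)"
    by (simp add: e_def power2_eq_square algebra_simps)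
  show ?thesis
  proof (cases "x j \<le> h - e")
    case True
    have "y j \<le> h - sway * e" unfolding yj
      by (rule move_towards_le[OF xb(2) True e(1) s0 sj(2,3)])
    moreover have "y i \<le> h - sway * e" unfolding yi
      by (rule move_towards_le[OF xb(2) True e(1) s0 si])
    moreover have "z j \<le> h - sway * (sway * e)" unfolding zj
      by (rule move_towards_le[OF yb(4) calculation(1) s1(2) s0 sj(2,3)])
    moreover have "z k \<le> h - sway * (sway * e)" unfolding zk
      by (rule move_towards_le[OF yb(4) calculation(1) s1(2) s0 sk])
    ultimately have "trapped l (h - sway * (sway * e)) z"
      using tz s1 zi unfolding trapped_def by auto
    moreover have "h - sway * (sway * e) \<le> h" using s1 s0 by simp
    ultimately show ?thesis
      unfolding fold_eq using size
      by (intro exI[of _ l] exI[of _ "h - sway * (sway * e)"]) simp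
  next
    case False
    then have j: "x j \<ge> l + e" by (simp add: e_def field_simps)
    have "y j \<ge> l + sway * e" unfolding yj
      by (rule move_towards_ge[OF xb(1) j e(1) s0 sj(2,3)])
    moreover have "y i \<ge> l + sway * e" unfolding yi
      by (rule move_towards_ge[OF xb(1) j e(1) s0 si])
    moreover have "z j \<ge> l + sway * (sway * e)" unfolding zj
      by (rule move_towards_ge[OF yb(3) calculation(1) s1(2) s0 sj(2,3)])
    moreover have "z k \<ge> l + sway * (sway * e)" unfolding zk
      by (rule move_towards_ge[OF yb(3) calculation(1) s1(2) s0 sk])
    ultimately have "trapped (l + sway * (sway * e)) h z"
      using tz s1 zi unfolding trapped_def by auto
    moreover have "l \<le> l + sway * (sway * e)" using s1 s0 by simp
    ultimately show ?thesis
      unfolding fold_eq using size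
      by (intro exI[of _ "l + sway * (sway * e)"] exI[of _ h]) simp
  qed
qed

text \<open>Recurrence of the contracting word makes the diameter tend to \<open>0\<close>, and the enclosing intervals
  never grow.\<close>

lemma gathered_consensus:
  assumes \<omega>: "\<And>t. \<omega> t \<in> agent_pairs n"
    and recurs: "\<And>T. \<exists>t\<ge>T. occurs_at \<omega> t [meet i j, meet j k]"
    and gath: "gathered (state x \<omega> T)"
  shows "\<exists>c. \<forall>a\<in>{i, j, k}. (\<lambda>t. state x \<omega> t a) \<longlonglongrightarrow> c"
    and "m \<in> {1..n} - {i, j, k} \<Longrightarrow> (\<lambda>t. state x \<omega> t m) \<longlonglongrightarrow> spot m"
proof -
  define \<rho> where "\<rho> = 1 - sway\<^sup>2 / 2"
  have "sway\<^sup>2 \<le> 1" using sway by (simp add: power_le_one)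
  then have \<rho>: "0 \<le> \<rho>" "\<rho> < 1" using sway(1) by (simp_all add: \<rho>_def)
  have shrink: "\<exists>t\<ge>T. \<exists>l h. trapped l h (state x \<omega> t) \<and> 0 \<le> l \<and> h \<le> 2 * r j \<and> h - l \<le> \<rho> ^ m * r k" for m
  proof (induction m)
    case 0
    then show ?case using gath by (auto simp: gathered_def)
  next
    case (Suc m)
    then obtain t l h where t: "t \<ge> T" "trapped l h (state x \<omega> t)" and lh: "0 \<le> l" "h \<le> 2 * r j"
      and d: "h - l \<le> \<rho> ^ m * r k" by blast
    have "\<rho> ^ m * r k \<le> r k" using \<rho> trio_pos(3) by (simp add: mult_le_cancel_right1 power_le_one)
    with d have d': "h - l \<le> r k" by simp
    obtain s where s: "s \<ge> t" "occurs_at \<omega> s [meet i j, meet j k]" using recurs by blast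
    have "trapped l h (state x \<omega> s)"
      by (rule trapped_state[OF \<omega> t(2) lh s(1)])
    from diameter_contracts[OF this lh d'] line_state_word[OF s(2), of r \<mu> x]
    obtain l' h' where l': "trapped l' h' (state x \<omega> (s + length [meet i j, meet j k]))" "l \<le> l'" "h' \<le> h"
      and "h' - l' = \<rho> * (h - l)" unfolding \<rho>_def by auto
    moreover from this(4) have "h' - l' \<le> \<rho> ^ Suc m * r k"
      using mult_left_mono[OF d \<rho>(1)] by (simp add: mult.assoc)
    moreover have "T \<le> s + length [meet i j, meet j k]" using s(1) t(1) by simp
    ultimately show ?case
      using lh by (meson order_trans)
  qed
  have close: "\<exists>t\<ge>T. \<exists>l h. (\<forall>s\<ge>t. trapped l h (state x \<omega> s)) \<and> h - l < \<epsilon>" if "\<epsilon> > 0" for \<epsilon>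
  proof -
    have "(\<lambda>m. \<rho> ^ m * r k) \<longlonglongrightarrow> 0 * r k"
      using \<rho> by (intro tendsto_mult tendsto_const LIMSEQ_realpow_zero) auto
    then have "eventually (\<lambda>m. \<rho> ^ m * r k < \<epsilon>) sequentially"
      using that by (intro order_tendstoD(2)) auto
    then obtain m where m: "\<rho> ^ m * r k < \<epsilon>" by (auto simp: eventually_sequentially)
    obtain t l h where "t \<ge> T" "trapped l h (state x \<omega> t)" "0 \<le> l" "h \<le> 2 * r j" "h - l \<le> \<rho> ^ m * r k"
      using shrink[of m] by blast
    then show ?thesis using trapped_state[of \<omega> l h x t] \<omega> m
      by (intro exI[of _ t] conjI exI[of _ l] exI[of _ h]) auto
  qed
  have near: "\<exists>t. \<forall>s\<ge>t. \<forall>s'\<ge>t. \<bar>state x \<omega> s a - state x \<omega> s' b\<bar> < \<epsilon>"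
    if ab: "\<epsilon> > 0" "a \<in> {i, j, k}" "b \<in> {i, j, k}" for a b \<epsilon>
  proof -
    obtain t l h where t: "\<And>s. s \<ge> t \<Longrightarrow> trapped l h (state x \<omega> s)" "h - l < \<epsilon>"
      using close[OF ab(1)] by blast
    have "\<bar>state x \<omega> s a - state x \<omega> s' b\<bar> < \<epsilon>" if "s \<ge> t" "s' \<ge> t" for s s'
    proof -
      have "{state x \<omega> s a, state x \<omega> s' b} \<subseteq> {l..h}"
        using t(1)[OF that(1)] t(1)[OF that(2)] ab(2,3) by (auto simp: trapped_def)
      with t(2) show ?thesis by auto
    qed
    then show ?thesis by blast
  qed
  have "Cauchy (\<lambda>t. state x \<omega> t i)"
    using near[of _ i i] by (auto simp: Cauchy_def dist_real_def)
  then obtain c where c: "(\<lambda>t. state x \<omega> t i) \<longlonglongrightarrow> c"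
    using Cauchy_convergent by (auto simp: convergent_def)
  have "(\<lambda>t. state x \<omega> t a) \<longlonglongrightarrow> c" if a: "a \<in> {i, j, k}" for a
  proof -
    have "(\<lambda>t. state x \<omega> t a - state x \<omega> t i) \<longlonglongrightarrow> 0"
    proof (rule LIMSEQ_I)
      fix \<epsilon> :: real assume "\<epsilon> > 0"
      from near[OF this a, of i] show "\<exists>t. \<forall>s\<ge>t. norm (state x \<omega> s a - state x \<omega> s i - 0) < \<epsilon>"
        by auto
    qed
    from tendsto_add[OF this c] show ?thesis by simp
  qed
  then show "\<exists>c. \<forall>a\<in>{i, j, k}. (\<lambda>t. state x \<omega> t a) \<longlonglongrightarrow> c" by blast
  assume m: "m \<in> {1..n} - {i, j, k}"
  obtain t l h where "\<And>s. s \<ge> t \<Longrightarrow> trapped l h (state x \<omega> s)"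
    using close[of 1] by auto
  then have "eventually (\<lambda>s. state x \<omega> s m = spot m) sequentially"
    using m unfolding eventually_sequentially trapped_def by blast
  then show "(\<lambda>t. state x \<omega> t m) \<longlonglongrightarrow> spot m"
    by (rule tendsto_eventually)
qed

section \<open>Pulling the trio together\<close>

text \<open>Meetings of \<open>i\<close> and \<open>j\<close> alone. As long as they are more than \<open>r i\<close> apart only \<open>j\<close> moves, and a distance
  that drops to at most \<open>r i\<close> is still at least \<open>(1 - \<mu> j) * r i\<close>; hence the first meeting in which \<open>i\<close> moves takes \<open>i\<close> at
  least \<open>\<mu> i * g\<close> towards \<open>j\<close>. Consequently, once the distance is below \<open>g\<close>, agent \<open>i\<close> has made
  definite progress.\<close>

lemma draw_together:
  fixes m :: nat
  assumes order: "x j \<le> x i" "x i - x j \<le> r j"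
    and g: "0 \<le> g" "g \<le> x i - x j" "g \<le> (1 - \<mu> j) * r i"
  defines "y \<equiv> fold step (replicate m (meet i j)) x"
  shows "x j \<le> y j" "y j \<le> y i" "y i \<le> x i" "y i - y j \<le> (1 - \<mu> j) ^ m * (x i - x j)"
    and "g \<le> y i - y j \<or> y i \<le> x i - \<mu> i * g"
    and "c \<noteq> i \<Longrightarrow> c \<noteq> j \<Longrightarrow> y c = x c"
proof -
  define z where "z m = fold step (replicate m (meet i j)) x" for m
  have "x j \<le> z m j \<and> z m j \<le> z m i \<and> z m i \<le> x i \<and> z m i - z m j \<le> (1 - \<mu> j) ^ m * (x i - x j) \<and>
    (g \<le> z m i - z m j \<or> z m i \<le> x i - \<mu> i * g) \<and> (\<forall>c. c \<noteq> i \<longrightarrow> c \<noteq> j \<longrightarrow> z m c = x c)"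
  proof (induction m)
    case 0
    then show ?case using order g by (simp add: z_def)
  next
    case (Suc m)
    define d where "d = z m i - z m j"
    have d: "0 \<le> d" "d \<le> r j" using Suc order by (simp_all add: d_def)
    have "z (Suc m) = step (meet i j) (z m)"
      by (simp add: z_def replicate_append_same[symmetric] del: replicate.simps)
    then have zs: "z (Suc m) = (z m)(i := z m i - \<mu> i * of_bool (d \<le> r i) * d, j := z m j + \<mu> j * d)"
      using d unfolding line_step_meet[OF distinct(1)] by (simp add: d_def abs_minus_commute algebra_simps)
    have zi: "z (Suc m) i = z m i - \<mu> i * of_bool (d \<le> r i) * d"
      and zj: "z (Suc m) j = z m j + \<mu> j * d" and zc: "\<And>c. c \<noteq> i \<Longrightarrow> c \<noteq> j \<Longrightarrow> z (Suc m) c = z m c"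
      using distinct by (simp_all add: zs)
    have mi: "0 \<le> \<mu> i * d" "0 \<le> \<mu> j * d" "\<mu> i * d + \<mu> j * d \<le> d"
      using trio_\<mu> d(1) mult_right_mono[of "\<mu> i + \<mu> j" 1 d] \<mu>_sum by (simp_all add: distrib_right)
    have pw: "d - \<mu> j * d \<le> (1 - \<mu> j) ^ Suc m * (x i - x j)"
    proof -
      have "d \<le> (1 - \<mu> j) ^ m * (x i - x j)" using Suc by (simp only: d_def)
      then have "(1 - \<mu> j) * d \<le> (1 - \<mu> j) * ((1 - \<mu> j) ^ m * (x i - x j))"
        using trio_\<mu> by (intro mult_left_mono) auto
      then show ?thesis by (simp add: left_diff_distrib)
    qed
    show ?case
    proof (cases "d \<le> r i")
      case True
      have "z (Suc m) i \<le> x i - \<mu> i * g"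
      proof (cases "g \<le> d")
        case gd: True
        have "\<mu> i * g \<le> \<mu> i * d" using gd trio_\<mu> by simp
        then show ?thesis using True Suc zi by simp
      next
        case False
        then show ?thesis using True Suc zi mi by (simp add: d_def)
      qed
      then show ?thesis
        using Suc zi zj zc mi pw True by (simp add: d_def)
    next
      case False
      have "(1 - \<mu> j) * r i \<le> (1 - \<mu> j) * d" using False trio_\<mu> by simp
      then have "g \<le> z (Suc m) i - z (Suc m) j"
        using g(3) False zi zj by (simp add: d_def algebra_simps)
      then show ?thesis
        using Suc zi zj zc mi pw False by (simp add: d_def)
    qed
  qed
  then show "x j \<le> y j" "y j \<le> y i" "y i \<le> x i" "y i - y j \<le> (1 - \<mu> j) ^ m * (x i - x j)"
    and "g \<le> y i - y j \<or> y i \<le> x i - \<mu> i * g"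
    and "c \<noteq> i \<Longrightarrow> c \<noteq> j \<Longrightarrow> y c = x c"
    by (simp_all add: y_def z_def)
qed

text \<open>A distance between \<open>i\<close> and \<open>j\<close> that every meeting of \<open>j\<close> with a motionless \<open>k\<close> restores: \<open>j\<close> then moves by
  \<open>\<mu> j\<close> times its distance to \<open>k\<close>, which is at least \<open>r k / 2\<close> as long as the trio is not within \<open>r k\<close> and \<open>i\<close> and \<open>j\<close> are close together.\<close>

definition gap :: real where
  "gap = \<mu> j * r k / 2"

text \<open>The situation right after a meeting of \<open>j\<close> and \<open>k\<close> in which only \<open>j\<close> has moved.\<close>

definition lined_up :: "(nat \<Rightarrow> real) \<Rightarrow> bool" where
  "lined_up x \<longleftrightarrow> trapped 0 (r j) x \<and> x k = 0 \<and> x j + gap \<le> x i"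

lemma gap: "0 < gap"
  using trio_pos trio_\<mu> by (simp add: gap_def)

lemma gatheredI:
  assumes "trapped 0 (r j) x" "0 \<le> l" "{x i, x j, x k} \<subseteq> {l..h}" "h - l \<le> r k" "h \<le> r j"
  shows "gathered x"
proof -
  have "trapped l h x" using assms(1,3) by (simp add: trapped_def)
  then show ?thesis
    unfolding gathered_def using assms(2,4,5) trio_pos(2) by (intro exI[of _ l] exI[of _ h]) simp
qed

text \<open>One round: \<open>j\<close> returns to \<open>i\<close>, drags it a fixed distance towards \<open>k\<close>, and then meets \<open>k\<close>. As long as \<open>j\<close> is beyond the
  confidence bound of \<open>k\<close> in that meeting, \<open>k\<close> stays where it is and another round can begin. Otherwise
  \<open>i\<close> is at most \<open>r k + \<eta>\<close> away from \<open>k\<close>, and the last meeting, which takes both \<open>j\<close> and \<open>k\<close> off the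
  lower end of the trio, brings the diameter down to \<open>r k\<close> or less.\<close>

lemma approach_round:
  assumes x: "lined_up x"
    and g: "0 \<le> g" "g \<le> gap" "g \<le> (1 - \<mu> j) * r i"
    and M: "(1 - \<mu> j) ^ M * r j \<le> \<eta>"
    and \<eta>: "\<eta> < g" "\<eta> \<le> min (\<mu> k) (1 - \<mu> j) * (r k / 2)"
  defines "z \<equiv> fold step (replicate M (meet i j) @ [meet j k]) x"
  shows "gathered z \<or> lined_up z \<and> z i \<le> x i - \<mu> i * g"
proof -
  define y where "y = fold step (replicate M (meet i j)) x"
  have z: "z = step (meet j k) y" by (simp add: z_def y_def)
  have tx: "trapped 0 (r j) x" and xk: "x k = 0" and xji: "x j + gap \<le> x i"
    using x by (simp_all add: lined_up_def)
  then have xb: "0 \<le> x j" "x j \<le> x i" "x i \<le> r j"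
    using gap by (simp_all add: trapped_def)
  have together: "x j \<le> y j" "y j \<le> y i" "y i \<le> x i" "y i - y j \<le> (1 - \<mu> j) ^ M * (x i - x j)"
    "g \<le> y i - y j \<or> y i \<le> x i - \<mu> i * g" "c \<noteq> i \<Longrightarrow> c \<noteq> j \<Longrightarrow> y c = x c" for c
    unfolding y_def by (rule draw_together; use xb xji g in simp)+
  have "(1 - \<mu> j) ^ M * (x i - x j) \<le> (1 - \<mu> j) ^ M * r j"
    using xb trio_\<mu> by (intro mult_left_mono) auto
  then have near: "y i - y j \<le> \<eta>" using together(4) M by linarith
  then have progress: "y i \<le> x i - \<mu> i * g" using together(5) \<eta>(1) by linarith
  have yk: "y k = 0" using together(6) distinct xk by simp
  have ty: "trapped 0 (r j) y"
  proof -
    have "{y i, y j, y k} \<subseteq> {0..r j}"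
      using yk together(1,2,3) xb trio_pos(2) by simp
    moreover have "\<forall>m\<in>{1..n} - {i, j, k}. y m = x m" using together(6) by simp
    ultimately show ?thesis using tx by (simp add: trapped_def)
  qed
  have tz: "trapped 0 (r j) z" unfolding z using ty distinct(3) by (simp add: trapped_meet)
  have yj: "0 \<le> y j" "y j \<le> r j" using ty by (simp_all add: trapped_def)
  have zs: "z = y(j := (1 - \<mu> j) * y j, k := \<mu> k * of_bool (y j \<le> r k) * y j)"
    unfolding z line_step_meet[OF distinct(3)] using yj yk by (simp add: algebra_simps)
  then have zj: "z j = (1 - \<mu> j) * y j" and zi: "z i = y i" and zk: "z k = \<mu> k * of_bool (y j \<le> r k) * y j"
    using distinct by simp_all
  define \<beta> where "\<beta> = min (\<mu> k) (1 - \<mu> j)"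
  have \<beta>: "0 \<le> \<beta>" "\<beta> \<le> 1" "\<beta> \<le> \<mu> k" "\<beta> \<le> 1 - \<mu> j" using trio_\<mu> by (auto simp: \<beta>_def)
  have zb: "0 \<le> z i" "z i \<le> r j" "0 \<le> z j" "0 \<le> z k" using tz by (simp_all add: trapped_def)
  have zj_le: "z j \<le> y j" using yj trio_\<mu> by (simp add: zj mult_left_le_one_le)
  show ?thesis
  proof (cases "y i \<le> r k")
    case True
    have "z k \<le> y i"
      using trio_\<mu> yj together(2) mult_left_le_one_le[of "y j" "\<mu> k"] zb by (cases "y j \<le> r k") (simp_all add: zk)
    with True have "gathered z"
      using zb zi zj_le together(2) r_le r_less by (intro gatheredI[OF tz, of 0 "r k"]) auto
    then show ?thesis ..
  next
    case False
    have "\<beta> * (r k / 2) \<le> 1 * (r k / 2)" using \<beta> trio_pos by (intro mult_right_mono) auto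
    then have "\<eta> \<le> r k / 2" using \<eta>(2) by (simp add: \<beta>_def)
    then have u: "r k / 2 \<le> y j" using False near by linarith
    show ?thesis
    proof (cases "y j \<le> r k")
      case True
      have "\<beta> * (r k / 2) \<le> \<beta> * y j" using u \<beta> by (intro mult_left_mono)
      moreover have "\<beta> * y j \<le> z j" "\<beta> * y j \<le> z k"
        using True \<beta> yj by (simp_all add: zj zk mult_right_mono)
      moreover have "z k \<le> y j"
        using trio_\<mu> yj mult_left_le_one_le[of "y j" "\<mu> k"] by (simp add: zk True)
      moreover have "z i - \<beta> * (r k / 2) \<le> r k"
        using True near \<eta>(2) by (simp add: zi \<beta>_def)
      moreover have "0 \<le> \<beta> * (r k / 2)" using \<beta> trio_pos by simp
      ultimately have "gathered z"
        using zb zi zj_le together(2)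
        by (intro gatheredI[OF tz, of "\<beta> * (r k / 2)" "z i"]) auto
      then show ?thesis ..
    next
      case far: False
      have "\<mu> j * (r k / 2) \<le> \<mu> j * y j" using u trio_\<mu> by (intro mult_left_mono) auto
      then have "z j + gap \<le> z i"
        using together(2) by (simp add: zj zi gap_def algebra_simps)
      then show ?thesis using tz progress far by (simp add: lined_up_def zk zi)
    qed
  qed
qed

lemma gathered_meet:
  assumes "gathered x" "a \<in> {i, j, k}" "b \<in> {i, j, k}" "a \<noteq> b"
  shows "gathered (step (meet a b) x)"
  using assms(1) trapped_meet[OF _ assms(2-4)] unfolding gathered_def by blast

lemma gathered_word:
  assumes "gathered x" "set w \<subseteq> {meet i j, meet j k}"
  shows "gathered (fold step w x)"
  using assms
proof (induction w arbitrary: x)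
  case (Cons p w)
  have "gathered (step p x)"
    using Cons.prems(2) gathered_meet[OF Cons.prems(1), of i j]
      gathered_meet[OF Cons.prems(1), of j k] distinct(1,3) by auto
  with Cons show ?case by simp
qed simp

text \<open>One word serves all lined-up states, which is what allows the time of its occurrence to be
  chosen before the initial state: every round without success takes at least the same amount off the opinion
  of \<open>i\<close>, which lies between \<open>0\<close> and \<open>r j\<close>.\<close>

lemma gathering_word:
  "\<exists>w. set w \<subseteq> {meet i j, meet j k} \<and> (\<forall>x. lined_up x \<longrightarrow> gathered (fold step w x))"
proof -
  define g where "g = min gap ((1 - \<mu> j) * r i)"
  define \<eta> where "\<eta> = min (g / 2) (min (\<mu> k) (1 - \<mu> j) * (r k / 2))"
  have g: "0 < g" "g \<le> gap" "g \<le> (1 - \<mu> j) * r i"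
    using gap trio_\<mu> trio_pos by (auto simp: g_def)
  have \<eta>: "0 < \<eta>" "\<eta> < g" "\<eta> \<le> min (\<mu> k) (1 - \<mu> j) * (r k / 2)"
    using g trio_\<mu> trio_pos by (auto simp: \<eta>_def)
  have "(\<lambda>M. (1 - \<mu> j) ^ M * r j) \<longlonglongrightarrow> 0 * r j"
    using trio_\<mu> by (intro tendsto_mult tendsto_const LIMSEQ_realpow_zero) auto
  then have "eventually (\<lambda>M. (1 - \<mu> j) ^ M * r j < \<eta>) sequentially"
    using \<eta> by (intro order_tendstoD(2)) auto
  then obtain M where M: "(1 - \<mu> j) ^ M * r j \<le> \<eta>"
    by (auto simp: eventually_sequentially intro: less_imp_le)
  define v where "v = replicate M (meet i j) @ [meet j k]"
  define w where "w N = concat (replicate N v)" for N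
  have v: "set v \<subseteq> {meet i j, meet j k}" by (auto simp: v_def)
  have "gathered (fold step (w N) x) \<or>
      lined_up (fold step (w N) x) \<and> fold step (w N) x i \<le> r j - N * (\<mu> i * g)" if "lined_up x" for N x
  proof (induction N)
    case 0
    then show ?case using that by (auto simp: w_def lined_up_def trapped_def)
  next
    case (Suc N)
    let ?y = "fold step (w N) x"
    have *: "fold step (w (Suc N)) x = fold step v ?y"
    proof -
      have "concat (replicate (Suc N) v) = concat (replicate N v @ [v])"
        by (simp only: replicate_append_same replicate.simps)
      then show ?thesis by (simp add: w_def del: replicate.simps)
    qed
    from Suc show ?case
    proof
      assume "gathered ?y"
      then show ?thesis using gathered_word[OF _ v] * by simp
    next
      assume y: "lined_up ?y \<and> ?y i \<le> r j - N * (\<mu> i * g)"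
      then have "gathered (fold step v ?y) \<or>
          lined_up (fold step v ?y) \<and> fold step v ?y i \<le> ?y i - \<mu> i * g"
        unfolding v_def using g M \<eta> by (intro approach_round) auto
      with y show ?thesis unfolding * by (auto simp: algebra_simps)
    qed
  qed
  moreover obtain N :: nat where "N * (\<mu> i * g) > r j"
    using reals_Archimedean3[of "\<mu> i * g"] g trio_\<mu> by auto
  moreover have "0 \<le> y i" if "lined_up y" for y
    using that by (simp add: lined_up_def trapped_def)
  ultimately have "gathered (fold step (w N) x)" if "lined_up x" for x
    using that by fastforce
  moreover have "set (w N) \<subseteq> {meet i j, meet j k}" using v by (auto simp: w_def)
  ultimately show ?thesis by blast
qed

section \<open>Delaying the first contact\<close>

lemma meet_distinct: "meet j k \<noteq> meet i j" "meet i k \<noteq> meet i j"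
proof -
  have "{a, b} = {a', b'}" if "meet a b = meet a' b'" for a b a' b'
    using that by (auto simp: meet_def min_def max_def split: if_splits)
  then show "meet j k \<noteq> meet i j" "meet i k \<noteq> meet i j"
    using distinct by (metis doubleton_eq_iff)+
qed

text \<open>Before the first contact with \<open>k\<close> only the meetings of \<open>i\<close> and \<open>j\<close> have an effect. They contract the distance \<open>G\<close> of the two by
  \<open>q = 1 - \<mu> i - \<mu> j\<close> and preserve \<open>x j - \<kappa> * G\<close> for \<open>\<kappa> = \<mu> j / (\<mu> i + \<mu> j)\<close>, so the motion has a closed
  form. Since \<open>q > 0\<close>, each such meeting strictly decreases \<open>x j\<close>, and the initial state can be chosen so that \<open>x j\<close>
  becomes equal to \<open>r j\<close> in the meeting at time \<open>T\<close> and not earlier. Because \<open>r k \<le> r i < r j\<close>,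
  neither \<open>i\<close> nor \<open>k\<close> reacts to the other as long as \<open>x j \<ge> r j\<close> and \<open>x i > x j - (r j - r i)\<close>.\<close>

lemma delayed_start:
  assumes \<omega>: "\<And>t. \<omega> t \<in> agent_pairs n" and \<omega>T: "\<omega> T = meet i j"
  obtains x where "\<And>t. t \<le> T \<Longrightarrow> state x \<omega> t j - state x \<omega> t k > r j"
    and "lined_up (step (meet j k) (state x \<omega> (Suc T)))"
proof -
  define q where "q = 1 - (\<mu> i + \<mu> j)"
  define \<kappa> where "\<kappa> = \<mu> j / (\<mu> i + \<mu> j)"
  \<comment> \<open>The three bounds keep \<open>i\<close> beyond \<open>r i\<close> from \<open>k\<close>, make \<open>i\<close> react to \<open>j\<close>, and let \<open>j\<close> jump past \<open>i\<close> by at least \<open>gap\<close> when it first meets \<open>k\<close>.\<close>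
  define \<delta> where "\<delta> = min ((r j - r i) / 2) (min (r i) (\<mu> j * r j / 2))"
  define c :: "nat \<Rightarrow> nat" where "c t = (\<Sum>s<t. of_bool (\<omega> s = meet i j))" for t
  define G where "G t = \<delta> * q ^ c t" for t
  define p where "p t = spot(i := r j + \<kappa> * (G t - G (Suc T)) - G t, j := r j + \<kappa> * (G t - G (Suc T)), k := 0)" for t
  have q: "0 < q" "q < 1" using \<mu>_sum trio_\<mu> by (simp_all add: q_def)
  have \<kappa>: "0 < \<kappa>" "\<kappa> < 1" "\<kappa> * (1 - q) = \<mu> j"
    using trio_\<mu> by (simp_all add: \<kappa>_def q_def)
  have \<delta>: "0 < \<delta>" "\<delta> < r j - r i" "\<delta> \<le> r i" "\<delta> \<le> \<mu> j * r j / 2"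
    using trio_\<mu> trio_pos r_less by (auto simp: \<delta>_def min_less_iff_disj)
  have G: "0 < G t" "G t \<le> \<delta>" for t
    using q \<delta> by (auto simp: G_def power_le_one)
  have G_antimono: "G t \<le> G s" if "s \<le> t" for s t
    using that q \<delta> unfolding G_def c_def
    by (intro mult_left_mono power_decreasing sum_mono2) auto
  have G_T: "G (Suc T) < G t" if "t \<le> T" for t
  proof -
    have "G (Suc T) = q * G T" using \<omega>T by (simp add: G_def c_def)
    also have "\<dots> < G T" using q G[of T] by simp
    finally show ?thesis using G_antimono[OF that] by simp
  qed
  have lead: "0 \<le> \<kappa> * (G t - G (Suc T))" "\<kappa> * (G t - G (Suc T)) \<le> G t" if "t \<le> Suc T" for t
  proof -
    show "0 \<le> \<kappa> * (G t - G (Suc T))" using \<kappa> G_antimono[OF that] by simp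
    have "\<kappa> * (G t - G (Suc T)) \<le> 1 * (G t - G (Suc T))"
      using \<kappa> G_antimono[OF that] by (intro mult_right_mono) auto
    then show "\<kappa> * (G t - G (Suc T)) \<le> G t" using G[of "Suc T"] by simp
  qed
  have pi: "p t i = r j + \<kappa> * (G t - G (Suc T)) - G t" and pj: "p t j = r j + \<kappa> * (G t - G (Suc T))"
    and pk: "p t k = 0" for t
    using distinct by (simp_all add: p_def)
  have po: "p t m = spot m" if "m \<notin> {i, j, k}" for t m
    using that by (simp add: p_def)
  have trap: "trapped 0 (2 * r j) (p t)" if "t \<le> Suc T" for t
  proof -
    have "{p t i, p t j, p t k} \<subseteq> {0..2 * r j}"
      using lead[OF that] G[of t] \<delta> trio_pos r_less by (simp add: pi pj pk)
    then show ?thesis using po unfolding trapped_def by blast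
  qed
  have st: "state (p 0) \<omega> t = p t" if "t \<le> Suc T" for t
    using that
  proof (induction t)
    case (Suc t)
    then have IH: "state (p 0) \<omega> t = p t" and t: "t \<le> T" by simp_all
    have same: "p (Suc t) = p t" if "\<omega> t \<noteq> meet i j"
      using that by (simp add: p_def G_def c_def)
    consider "\<omega> t = meet i j" | "\<omega> t = meet j k" | "\<omega> t = meet i k"
      | "\<omega> t \<notin> {meet i j, meet i k, meet j k}" by blast
    then have "step (\<omega> t) (p t) = p (Suc t)"
    proof cases
      case 1
      then have Gs: "G (Suc t) = q * G t" by (simp add: G_def c_def)
      have "p t j - p t i = G t" by (simp add: pi pj)
      moreover have "\<bar>G t\<bar> \<le> r i" "\<bar>G t\<bar> \<le> r j" using G[of t] \<delta> r_less by auto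
      ultimately have s: "step (\<omega> t) (p t) = (p t)(i := p t i + \<mu> i * G t, j := p t j + \<mu> j * (p t i - p t j))"
        unfolding 1 line_step_meet[OF distinct(1)] by simp
      have "p t j + \<mu> j * (p t i - p t j) = p (Suc t) j"
        unfolding pi pj Gs \<kappa>(3)[symmetric] by (simp add: algebra_simps)
      moreover have \<mu>_i: "\<mu> i = 1 - q - \<kappa> * (1 - q)" unfolding \<kappa>(3) by (simp add: q_def)
      have "p t i + \<mu> i * G t = p (Suc t) i"
        unfolding pi pj Gs \<mu>_i by (simp add: algebra_simps)
      ultimately show ?thesis
        unfolding s using distinct by (auto simp: fun_eq_iff p_def)
    next
      case 2
      have "p t j > r j" using G_T[OF t] \<kappa> by (simp add: pj)
      then have "\<bar>p t k - p t j\<bar> > r j" using trio_pos by (simp add: pk)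
      then have "step (\<omega> t) (p t) = p t"
        unfolding 2 line_step_meet[OF distinct(3)] using r_le r_less by simp
      then show ?thesis using same meet_distinct(1) 2 by simp
    next
      case 3
      have "p t i > r i" using lead(1)[of t] t G[of t] \<delta> by (simp add: pi)
      then have "\<bar>p t k - p t i\<bar> > r i" using trio_pos by (simp add: pk)
      then have "step (\<omega> t) (p t) = p t"
        unfolding 3 line_step_meet[OF distinct(2)] using r_le by simp
      then show ?thesis using same meet_distinct(2) 3 by simp
    next
      case 4
      then show ?thesis using step_other[OF \<omega> trap] t same by simp
    qed
    then show ?case by (simp add: IH)
  qed simp
  show ?thesis
  proof (rule that)
    show "state (p 0) \<omega> t j - state (p 0) \<omega> t k > r j" if "t \<le> T" for t
      using G_T[OF that] that \<kappa> by (simp add: st pj pk)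
    let ?y = "p (Suc T)"
    have y: "?y k = 0" "?y j = r j" "?y i = r j - G (Suc T)" by (simp_all add: pi pj pk)
    have ty: "trapped 0 (r j) ?y"
      using trap[of "Suc T"] G[of "Suc T"] y trio_pos by (simp add: trapped_def)
    have "step (meet j k) ?y = ?y(j := r j - \<mu> j * r j)"
      unfolding line_step_meet[OF distinct(3)] using y r_le r_less trio_pos distinct
      by (auto simp: fun_eq_iff)
    moreover have "\<mu> j * r k \<le> \<mu> j * r j"
      using r_le r_less trio_\<mu> by (intro mult_left_mono) auto
    then have "r j - \<mu> j * r j + gap \<le> r j - G (Suc T)"
      using G(2)[of "Suc T"] \<delta>(4) unfolding gap_def by linarith
    moreover have "trapped 0 (r j) (step (meet j k) ?y)"
      using ty distinct(3) by (simp add: trapped_meet)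
    ultimately show "lined_up (step (meet j k) (state (p 0) \<omega> (Suc T)))"
      unfolding st[OF order_refl] using y distinct by (simp add: lined_up_def)
  qed
qed

lemma meet_in_agent_pairs:
  "a \<in> {1..n} \<Longrightarrow> b \<in> {1..n} \<Longrightarrow> a \<noteq> b \<Longrightarrow> meet a b \<in> agent_pairs n"
  by (auto simp: meet_def agent_pairs_def min_def max_def)

text \<open>The word to wait for is the last harmless meeting of \<open>i\<close> and \<open>j\<close>, the first contact of \<open>j\<close> with \<open>k\<close>, and the
  gathering word. The initial state is tuned to an occurrence of it after time \<open>T\<close>.\<close>

lemma AE_late_gathering:
  "AE \<omega> in pair_sequences n. \<forall>T. \<exists>x. \<exists>c. (\<forall>a\<in>{i, j, k}. (\<lambda>t. state x \<omega> t a) \<longlonglongrightarrow> c) \<and>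
    (\<forall>m\<in>{1..n} - {i, j, k}. (\<lambda>t. state x \<omega> t m) \<longlonglongrightarrow> spot m) \<and>
    (\<forall>t\<le>T. state x \<omega> t j - state x \<omega> t k > r j)"
proof -
  obtain w where w: "set w \<subseteq> {meet i j, meet j k}" "\<And>x. lined_up x \<Longrightarrow> gathered (fold step w x)"
    using gathering_word by blast
  let ?z = "[meet i j, meet j k]"
  have fin: "finite (agent_pairs n)"
    by (rule finite_subset[of _ "{1..n} \<times> {1..n}"]) (auto simp: agent_pairs_def)
  have zw: "set (?z @ w) \<subseteq> agent_pairs n" "set ?z \<subseteq> agent_pairs n"
    using w(1) meet_in_agent_pairs members distinct by auto
  have *: "AE \<omega> in pair_sequences n. \<forall>t. \<omega> t \<in> agent_pairs n"
    by (rule AE_I2) (auto simp: pair_sequences_def space_PiM PiE_iff space_uniform_count_measure)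
  show ?thesis
    using AE_word_recurs[OF fin zw(1), folded pair_sequences_def, simplified]
      AE_word_recurs[OF fin zw(2), folded pair_sequences_def, simplified] *
  proof eventually_elim
    case (elim \<omega>)
    show ?case
    proof
      fix T
      obtain s where s: "s \<ge> T" "occurs_at \<omega> s (?z @ w)" using elim(1) by auto
      then have z: "occurs_at \<omega> s ?z" and ow: "occurs_at \<omega> (s + length ?z) w"
        unfolding occurs_at_append by simp_all
      from z have \<omega>s: "\<omega> s = meet i j" "\<omega> (Suc s) = meet j k"
        by (auto simp: occurs_at_def less_Suc_eq)
      obtain x where x: "\<And>t. t \<le> s \<Longrightarrow> state x \<omega> t j - state x \<omega> t k > r j"
        and l: "lined_up (step (meet j k) (state x \<omega> (Suc s)))"
        using delayed_start[of \<omega> s] elim(3) \<omega>s(1) by blast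
      have "lined_up (state x \<omega> (s + length ?z))" using l \<omega>s(2) by simp
      from w(2)[OF this] have g: "gathered (state x \<omega> (s + length ?z + length w))"
        by (subst line_state_word[OF ow])
      obtain c where c: "\<forall>a\<in>{i, j, k}. (\<lambda>t. state x \<omega> t a) \<longlonglongrightarrow> c"
        using gathered_consensus(1)[OF _ _ g] elim(2,3) by blast
      have others: "\<forall>m\<in>{1..n} - {i, j, k}. (\<lambda>t. state x \<omega> t m) \<longlonglongrightarrow> spot m"
        using gathered_consensus(2)[OF _ _ g] elim(2,3) by blast
      have "\<forall>t\<le>T. state x \<omega> t j - state x \<omega> t k > r j" using x s(1) by simp
      with c others show "\<exists>x. \<exists>c. (\<forall>a\<in>{i, j, k}. (\<lambda>t. state x \<omega> t a) \<longlonglongrightarrow> c) \<and>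
        (\<forall>m\<in>{1..n} - {i, j, k}. (\<lambda>t. state x \<omega> t m) \<longlonglongrightarrow> spot m) \<and>
        (\<forall>t\<le>T. state x \<omega> t j - state x \<omega> t k > r j)"
        by (intro exI[of _ x] exI[of _ c] conjI)
    qed
  qed
qed

end

section \<open>Unbounded convergence times\<close>

lemma dw_conv_time_gt:
  assumes conv: "dw_converges n r \<mu> X0 \<omega>" and n: "n \<ge> 1" and \<epsilon>: "\<epsilon> > 0"
    and late: "\<And>t. t \<le> T \<Longrightarrow>
      \<exists>a\<in>{1..n}. norm (dw_state r \<mu> X0 \<omega> t a - lim (\<lambda>s. dw_state r \<mu> X0 \<omega> s a)) > \<epsilon>"
  shows "dw_conv_time n r \<mu> X0 \<omega> \<epsilon> > T"
proof -
  define D where "D t a = norm (dw_state r \<mu> X0 \<omega> t a - lim (\<lambda>s. dw_state r \<mu> X0 \<omega> s a))" for t a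
  have Max_le: "Max (D t ` {1..n}) \<le> \<epsilon> \<longleftrightarrow> (\<forall>a\<in>{1..n}. D t a \<le> \<epsilon>)" for t
    using n by (subst Max_le_iff) auto
  have "eventually (\<lambda>t. D t a \<le> \<epsilon>) sequentially" if "a \<in> {1..n}" for a
  proof -
    have "(\<lambda>t. D t a) \<longlonglongrightarrow> 0"
      using conv that unfolding D_def dw_converges_def convergent_LIMSEQ_iff
      by (intro tendsto_norm_zero) (simp add: LIM_zero)
    from order_tendstoD(2)[OF this \<epsilon>] show ?thesis
      by eventually_elim simp
  qed
  then have "eventually (\<lambda>t. \<forall>a\<in>{1..n}. D t a \<le> \<epsilon>) sequentially"
    by (simp add: eventually_ball_finite)
  from eventually_conj[OF this eventually_gt_at_top[of 0]]
  obtain t where "t > 0 \<and> Max (D t ` {1..n}) \<le> \<epsilon>"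
    unfolding Max_le eventually_sequentially by blast
  from LeastI[of "\<lambda>t. t > 0 \<and> Max (D t ` {1..n}) \<le> \<epsilon>", OF this]
  have "Max (D (dw_conv_time n r \<mu> X0 \<omega> \<epsilon>) ` {1..n}) \<le> \<epsilon>"
    by (simp add: dw_conv_time_def D_def)
  then show ?thesis
    unfolding Max_le using late unfolding D_def by (metis not_le)
qed

lemma SUP_enat_eq_infinity:
  assumes "\<And>T. \<exists>x\<in>A. f x > T"
  shows "(SUP x\<in>A. enat (f x)) = \<infinity>"
proof (rule ccontr)
  assume "(SUP x\<in>A. enat (f x)) \<noteq> \<infinity>"
  then obtain T where T: "(SUP x\<in>A. enat (f x)) = enat T" by auto
  obtain x where "x \<in> A" "f x > T" using assms by blast
  then show False using SUP_upper[of x A "\<lambda>x. enat (f x)"] T by simp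
qed

theorem theorem2:
  fixes n :: nat and r \<mu> :: "nat \<Rightarrow> real" and i j k :: nat
  assumes "n \<ge> 3"
    and "\<And>a. a \<in> {1..n} \<Longrightarrow> r a > 0"
    and "\<And>a. a \<in> {1..n} \<Longrightarrow> 0 < \<mu> a \<and> \<mu> a < 1"
    and "i \<in> {1..n}" "j \<in> {1..n}" "k \<in> {1..n}"
    and "i \<noteq> j" "i \<noteq> k" "j \<noteq> k"
    and "r k \<le> r i" "r i < r j"
    and "(\<mu> i < 1/2 \<and> \<mu> j \<le> 1/2) \<or> (\<mu> i \<le> 1/2 \<and> \<mu> j < 1/2)"
  shows "AE \<omega> in pair_sequences n.
    (SUP X0 \<in> {X0 :: nat \<Rightarrow> real ^ 'd. dw_converges n r \<mu> X0 \<omega>}.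
       enat (dw_conv_time n r \<mu> X0 \<omega> (r j / 2))) = \<infinity>"
proof -
  have "\<mu> i + \<mu> j < 1" using assms(12) by linarith
  interpret dw_trio n r \<mu> i j k
    by (rule dw_trio.intro[OF assms(2-11)]) (assumption | fact)+
  define e :: "real ^ 'd" where "e = axis undefined 1"
  have e: "norm e = 1" by (simp add: e_def norm_axis_1)
  show ?thesis
    using AE_late_gathering
  proof eventually_elim
    case (elim \<omega>)
    show ?case
    proof (rule SUP_enat_eq_infinity)
      fix T
      from spec[OF elim, of T] obtain x c
        where trio: "\<forall>a\<in>{i, j, k}. (\<lambda>t. state x \<omega> t a) \<longlonglongrightarrow> c"
          and others: "\<forall>m\<in>{1..n} - {i, j, k}. (\<lambda>t. state x \<omega> t m) \<longlonglongrightarrow> spot m"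
          and apart: "\<forall>t\<le>T. state x \<omega> t j - state x \<omega> t k > r j"
        by (elim exE conjE) (rule that)
      let ?X = "\<lambda>a. x a *\<^sub>R e"
      note on_line = dw_state_on_line[OF e]
      have conv: "dw_converges n r \<mu> ?X \<omega>"
        unfolding dw_converges_def on_line
      proof
        fix a assume a: "a \<in> {1..n}"
        obtain b where "(\<lambda>t. state x \<omega> t a) \<longlonglongrightarrow> b"
          using bspec[OF trio, of a] bspec[OF others, of a] a by blast
        then have "(\<lambda>t. state x \<omega> t a *\<^sub>R e) \<longlonglongrightarrow> b *\<^sub>R e"
          by (intro tendsto_intros)
        then show "convergent (\<lambda>t. state x \<omega> t a *\<^sub>R e)" by (rule convergentI)
      qed
      have dev: "norm (dw_state r \<mu> ?X \<omega> t a - lim (\<lambda>s. dw_state r \<mu> ?X \<omega> s a)) = \<bar>state x \<omega> t a - c\<bar>"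
        if "a \<in> {i, j, k}" for a t
      proof -
        have "(\<lambda>s. dw_state r \<mu> ?X \<omega> s a) \<longlonglongrightarrow> c *\<^sub>R e"
          unfolding on_line by (intro tendsto_scaleR tendsto_const bspec[OF trio that])
        from limI[OF this] show ?thesis
          using e by (simp add: on_line flip: scaleR_diff_left)
      qed
      have "dw_conv_time n r \<mu> ?X \<omega> (r j / 2) > T"
      proof (rule dw_conv_time_gt[OF conv])
        fix t assume "t \<le> T"
        with apart have "state x \<omega> t j - state x \<omega> t k > r j" by simp
        \<comment> \<open>Opinions more than \<open>r j\<close> apart cannot both be within \<open>r j / 2\<close> of the common limit.\<close>
        then have "\<bar>state x \<omega> t j - c\<bar> > r j / 2 \<or> \<bar>state x \<omega> t k - c\<bar> > r j / 2"
          by linarith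
        then show "\<exists>a\<in>{1..n}. norm (dw_state r \<mu> ?X \<omega> t a - lim (\<lambda>s. dw_state r \<mu> ?X \<omega> s a)) > r j / 2"
          using dev[of j t] dev[of k t] members(2,3) by (metis insertI1 insertI2)
      qed (use assms(1) trio_pos(2) in simp_all)
      with conv show "\<exists>X0\<in>{X0 :: nat \<Rightarrow> real ^ 'd. dw_converges n r \<mu> X0 \<omega>}.
          dw_conv_time n r \<mu> X0 \<omega> (r j / 2) > T"
        by blast
    qed
  qed
qed

end
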